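(* Let $S$ be a numerical semigroup with conductor $c(S)$ and multiplicity $m(S)$, and let $m,n\ge 1$ be integers. Let $m' := \min\{s\in S : s\ge m\}$, let $D_A$ be the set formed by the $m$ smallest elements of the Apéry set $\mathrm{Ap}(S,m')$, and let $D_B := \{0,m',2m',\ldots,(n-1)m'\}$. Then $D_A,D_B$ is a solution to the AG polynomial code problem (for $S$, $m$, $n$), and its recovery threshold satisfies $$\max(D_A)+\max(D_B)+1\ \le\ c(S)+m'n\ \le\ c(S)+(m+m(S)-1)\,n.$$ Moreover, if $m\in S$, then $m'=m$ and $\max(D_A)+\max(D_B)+1=c(S)+mn$.
   Context: $\mathbb{N}=\{0,1,2,\dots\}$. A numerical semigroup is a set $S\subseteq\mathbb{N}$ with $0\in S$, closed under addition, and with $\mathbb{N}\setminus S$ finite. Its conductor is $c(S)=\min\{s\in S : \text{every integer } x\ge s\text{ lies in }S\}$ and its multiplicity is $m(S)=\min(S\setminus\{0\})$. For $k\in S\setminus\{0\}$, the Apéry set is $\mathrm{Ap}(S,k)=\{s\in S : s-k\notin S\}$ (it has exactly $k$ elements). Given $m,n\ge1$, a pair $D_A,D_B\subseteq S$ is a solution to the AG polynomial code problem if $|D_A|=m$, $|D_B|=n$, and $a+b\neq a'+b'$ for all distinct pairs $(a,b),(a',b')\in D_A\times D_B$. Its recovery threshold is $\max(D_A)+\max(D_B)+1$. *)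

theory Defs
  imports Main
begin

definition numerical_semigroup :: "nat set \<Rightarrow> bool" where
  "numerical_semigroup S \<longleftrightarrow>
     0 \<in> S \<and> (\<forall>x\<in>S. \<forall>y\<in>S. x + y \<in> S) \<and> finite (UNIV - S)"

definition conductor :: "nat set \<Rightarrow> nat" where
  "conductor S = (LEAST s. s \<in> S \<and> (\<forall>x\<ge>s. x \<in> S))"

definition multiplicity :: "nat set \<Rightarrow> nat" where
  "multiplicity S = (LEAST s. s \<in> S - {0})"

(* The difference s - k is taken in the integers: elements s < k of S always belong to
   the Apery set, which truncated subtraction on nat would get wrong. *)
definition Apery :: "nat set \<Rightarrow> nat \<Rightarrow> nat set" where
  "Apery S k = {s \<in> S. int s - int k \<notin> int ` S}"

(* The set of the m smallest elements of A (all of A if A has at most m elements). *)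
definition smallest :: "nat \<Rightarrow> nat set \<Rightarrow> nat set" where
  "smallest m A = {a \<in> A. card {b \<in> A. b < a} < m}"

definition AG_poly_code_solution ::
  "nat set \<Rightarrow> nat \<Rightarrow> nat \<Rightarrow> nat set \<Rightarrow> nat set \<Rightarrow> bool" where
  "AG_poly_code_solution S m n D\<^sub>A D\<^sub>B \<longleftrightarrow>
     D\<^sub>A \<subseteq> S \<and> D\<^sub>B \<subseteq> S \<and> card D\<^sub>A = m \<and> card D\<^sub>B = n \<and>
     (\<forall>a\<in>D\<^sub>A. \<forall>b\<in>D\<^sub>B. \<forall>a'\<in>D\<^sub>A. \<forall>b'\<in>D\<^sub>B.
        (a, b) \<noteq> (a', b') \<longrightarrow> a + b \<noteq> a' + b')"

definition recovery_threshold :: "nat set \<Rightarrow> nat set \<Rightarrow> nat" where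
  "recovery_threshold D\<^sub>A D\<^sub>B = Max D\<^sub>A + Max D\<^sub>B + 1"

end

theory Submission
  imports Defs
begin

text \<open>Reduction modulo \<open>k\<close> is a bijection from \<open>Ap(S, k)\<close> onto the residues, since an element
  of \<open>S\<close> lies in \<open>Ap(S, k)\<close> iff it is the least one in its residue class. So sums of an Apery
  element and a multiple of \<open>m'\<close> are pairwise distinct. The largest element of \<open>Ap(S, k)\<close> is the
  Frobenius number \<open>c(S) - 1\<close> plus \<open>k\<close>, which gives the recovery threshold.\<close>

section \<open>Multiples, conductor and multiplicity\<close>

lemma numerical_semigroup_mult:
  assumes "numerical_semigroup S" "x \<in> S"
  shows "i * x \<in> S"
  using assms by (induction i) (auto simp: numerical_semigroup_def)

lemma conductor_spec:
  assumes "numerical_semigroup S"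
  shows "conductor S \<in> S \<and> (\<forall>x\<ge>conductor S. x \<in> S)"
proof -
  have "finite (UNIV - S)"
    using assms by (simp add: numerical_semigroup_def)
  then obtain N where N: "\<forall>x\<in>UNIV - S. x < N"
    using finite_nat_set_iff_bounded by blast
  have "N \<in> S \<and> (\<forall>x\<ge>N. x \<in> S)"
    using N by (metis DiffI UNIV_I leD le_refl)
  then show ?thesis
    unfolding conductor_def by (rule LeastI)
qed

text \<open>Otherwise the tail contained in \<open>S\<close> would start one step earlier, against
  minimality. When the conductor is 0, truncated subtraction gives 0, which is in
  \<open>S\<close>.\<close>

lemma pred_conductor_notin:
  assumes "numerical_semigroup S" "conductor S > 0"
  shows "conductor S - 1 \<notin> S"
proof
  assume *: "conductor S - 1 \<in> S"
  have "x \<in> S" if "x \<ge> conductor S - 1" for x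
    using * conductor_spec[OF assms(1)] that by (cases "x = conductor S - 1") auto
  with * have "conductor S \<le> conductor S - 1"
    by (subst conductor_def) (auto intro: Least_le)
  with assms(2) show False by simp
qed

lemma multiplicity_spec:
  assumes "numerical_semigroup S"
  shows "multiplicity S \<in> S - {0}"
proof -
  have "Suc (conductor S) \<in> S - {0}"
    using conductor_spec[OF assms] by simp
  then show ?thesis
    unfolding multiplicity_def by (rule LeastI)
qed

text \<open>Any \<open>multiplicity S\<close> consecutive integers include a multiple of the
  multiplicity. This yields the upper bound on \<open>m'\<close>.\<close>

lemma semigroup_element_above:
  assumes "numerical_semigroup S"
  obtains s where "s \<in> S" "s \<ge> m" "s \<le> m + multiplicity S - 1"
proof -
  define q where "q = multiplicity S"
  have q: "q \<in> S" "q > 0"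
    using multiplicity_spec[OF assms] by (auto simp: q_def)
  \<comment> \<open>The largest multiple of \<open>q\<close> up to \<open>m + q - 1\<close>; the
    remainder below \<open>q\<close> forces \<open>s \<ge> m\<close>.\<close>
  define s where "s = (m + q - 1) div q * q"
  have "s + (m + q - 1) mod q = m + q - 1"
    by (simp add: s_def)
  moreover have "(m + q - 1) mod q < q"
    using q by simp
  ultimately have "s \<ge> m" "s \<le> m + q - 1" by linarith+
  moreover have "s \<in> S"
    unfolding s_def by (rule numerical_semigroup_mult[OF assms q(1)])
  ultimately show ?thesis
    using that by (simp add: q_def)
qed

section \<open>Apery sets as minimal representatives of residue classes\<close>

lemma Apery_iff: "s \<in> Apery S k \<longleftrightarrow> s \<in> S \<and> (s < k \<or> s - k \<notin> S)"
proof (cases "s < k")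
  case True
  then show ?thesis by (auto simp: Apery_def)
next
  case False
  then have "int s - int k = int (s - k)" by simp
  with False show ?thesis
    by (simp only: Apery_def mem_Collect_eq inj_image_mem_iff[OF inj_of_nat]) simp
qed

text \<open>If \<open>a < b\<close>, then \<open>b\<close> exceeds \<open>a\<close> by a positive
  multiple of \<open>k\<close>, so \<open>b - k\<close> is \<open>a\<close> plus a multiple of
  \<open>k\<close> and lies in \<open>S\<close>, which membership in the Apery set forbids.\<close>

lemma Apery_minimal:
  assumes S: "numerical_semigroup S" and k: "k \<in> S"
    and a: "a \<in> S" and b: "b \<in> Apery S k" and eq: "a mod k = b mod k"
  shows "b \<le> a"
proof (rule ccontr)
  assume "\<not> b \<le> a"
  moreover from this have "k dvd b - a"
    using mod_eq_dvd_iff_nat[of a b k] eq by simp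
  then obtain j where "b - a = k * j" ..
  ultimately obtain i where "b - a = k * Suc i"
    by (cases j) auto
  then have "b \<ge> k" "b - k = a + i * k"
    using \<open>\<not> b \<le> a\<close> by (auto simp: algebra_simps)
  moreover have "a + i * k \<in> S"
    using S a numerical_semigroup_mult[OF S k] by (simp add: numerical_semigroup_def)
  ultimately show False
    using b by (simp add: Apery_iff)
qed

lemma inj_on_mod_Apery:
  assumes "numerical_semigroup S" "k \<in> S"
  shows "inj_on (\<lambda>a. a mod k) (Apery S k)"
proof (rule inj_onI)
  fix a b assume "a \<in> Apery S k" "b \<in> Apery S k" "a mod k = b mod k"
  then show "a = b"
    using Apery_minimal[OF assms, of a b] Apery_minimal[OF assms, of b a]
    by (simp add: Apery_iff)
qed

lemma bij_betw_mod_Apery: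
  assumes S: "numerical_semigroup S" and k: "k \<in> S" "k > 0"
  shows "bij_betw (\<lambda>a. a mod k) (Apery S k) {..<k}"
proof (rule bij_betw_imageI[OF inj_on_mod_Apery[OF S k(1)]])
  have "r \<in> (\<lambda>a. a mod k) ` Apery S k" if r: "r < k" for r
  proof -
    let ?P = "\<lambda>s. s \<in> S \<and> s mod k = r"
    define s where "s = (LEAST s. ?P s)"
    \<comment> \<open>A member of the residue class of \<open>r\<close> beyond the conductor, so the
      class meets \<open>S\<close> and its least element exists.\<close>
    have "conductor S \<le> conductor S * k + r"
      using k(2) by (cases k) auto
    then have "?P (conductor S * k + r)"
      using conductor_spec[OF S] r by simp
    then have s: "?P s"
      unfolding s_def by (rule LeastI)
    moreover have "s - k \<notin> S" if "s \<ge> k"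
    proof
      assume "s - k \<in> S"
      with s that have "?P (s - k)"
        by (simp add: le_mod_geq)
      then have "s \<le> s - k"
        unfolding s_def by (rule Least_le)
      with k(2) that show False by simp
    qed
    ultimately have "s \<in> Apery S k"
      by (auto simp: Apery_iff not_less)
    with s show ?thesis by blast
  qed
  then show "(\<lambda>a. a mod k) ` Apery S k = {..<k}"
    using k(2) by auto
qed

lemma
  assumes "numerical_semigroup S" "k \<in> S" "k > 0"
  shows finite_Apery: "finite (Apery S k)"
    and card_Apery: "card (Apery S k) = k"
  using bij_betw_finite[OF bij_betw_mod_Apery[OF assms]]
    bij_betw_same_card[OF bij_betw_mod_Apery[OF assms]] by simp_all

lemma Apery_le:
  assumes "numerical_semigroup S" "a \<in> Apery S k" "k > 0"
  shows "a \<le> conductor S + k - 1"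
proof (rule ccontr)
  assume "\<not> ?thesis"
  then have "a \<ge> k" "a - k \<ge> conductor S"
    using assms(3) by linarith+
  then show False
    using conductor_spec[OF assms(1)] assms(2) by (simp add: Apery_iff)
qed

text \<open>The upper bound is attained because subtracting \<open>k\<close> from it leaves
  \<open>conductor S - 1\<close>, which is a gap or negative.\<close>

lemma Max_Apery:
  assumes S: "numerical_semigroup S" and k: "k \<in> S" "k > 0"
  shows "Max (Apery S k) = conductor S + k - 1"
proof (rule Max_eqI)
  have "conductor S + k - 1 \<in> S"
    using conductor_spec[OF S] k(2) by simp
  moreover have "conductor S + k - 1 - k = conductor S - 1"
    by simp
  \<comment> \<open>If the conductor is 0, the element is \<open>k - 1\<close> and the disjunct
    \<open>s < k\<close> applies.\<close>
  ultimately show "conductor S + k - 1 \<in> Apery S k"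
    using pred_conductor_notin[OF S] k(2) by (cases "conductor S = 0") (simp_all add: Apery_iff)
qed (use Apery_le[OF S] finite_Apery[OF S k] k(2) in auto)

section \<open>Ranks and the smallest elements of a finite set\<close>

lemma bij_betw_rank:
  fixes A :: "nat set"
  assumes "finite A"
  shows "bij_betw (\<lambda>a. card {b \<in> A. b < a}) A {..<card A}"
proof -
  let ?r = "\<lambda>a. card {b \<in> A. b < a}"
  have less: "?r a < ?r b" if "a \<in> A" "a < b" for a b
    by (rule psubset_card_mono) (use assms that in auto)
  have inj: "inj_on ?r A"
  proof (rule inj_onI)
    fix a b assume "a \<in> A" "b \<in> A" "?r a = ?r b"
    then show "a = b"
      using less[of a b] less[of b a] by (metis less_irrefl nat_neq_iff)
  qed
  have "?r a < card A" if "a \<in> A" for a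
    by (rule psubset_card_mono) (use assms that in auto)
  then have "?r ` A \<subseteq> {..<card A}" by auto
  \<comment> \<open>The image of an injective map has \<open>card A\<close> elements, so it fills
    the range.\<close>
  then have "?r ` A = {..<card A}"
    by (rule card_subset_eq[rotated]) (simp_all add: card_image[OF inj])
  with inj show ?thesis by (rule bij_betw_imageI)
qed

lemma smallest_subset: "smallest m A \<subseteq> A"
  by (auto simp: smallest_def)

text \<open>The selected elements are those whose rank is below \<open>m\<close>, and rank is a
  bijection onto an initial segment containing all these values.\<close>

lemma card_smallest:
  assumes "finite A" "m \<le> card A"
  shows "card (smallest m A) = m"
proof -
  let ?r = "\<lambda>a. card {b \<in> A. b < a}"
  note bij = bij_betw_rank[OF assms(1)]
  have "?r ` smallest m A = ?r ` A \<inter> {..<m}"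
    by (auto simp: smallest_def)
  also have "\<dots> = {..<m}"
    using bij_betw_imp_surj_on[OF bij] assms(2) by auto
  finally have "?r ` smallest m A = {..<m}" .
  then show ?thesis
    using card_image[OF inj_on_subset[OF bij_betw_imp_inj_on[OF bij] smallest_subset], of m]
    by (metis card_lessThan)
qed

lemma smallest_card_self:
  assumes "finite A"
  shows "smallest (card A) A = A"
  using card_subset_eq[OF assms smallest_subset] card_smallest[OF assms] by simp

text \<open>Reducing a sum modulo \<open>k\<close> erases the second summand and so determines the
  first; cancellation then recovers the second.\<close>

lemma AG_poly_code_solution_Apery:
  assumes S: "numerical_semigroup S" and k: "k \<in> S" "k > 0"
    and A: "A \<subseteq> Apery S k" "card A = m"
  shows "AG_poly_code_solution S m n A ((\<lambda>i. i * k) ` {..<n})"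
proof -
  let ?B = "(\<lambda>i. i * k) ` {..<n}"
  have "A \<subseteq> S"
    using A(1) by (auto simp: Apery_iff)
  moreover have "?B \<subseteq> S"
    using numerical_semigroup_mult[OF S k(1)] by auto
  moreover have "card ?B = n"
    using k(2) by (subst card_image) (auto simp: inj_on_def)
  moreover have "a = a' \<and> b = b'"
    if "a \<in> A" "a' \<in> A" "b \<in> ?B" "b' \<in> ?B" "a + b = a' + b'" for a a' b b'
  proof -
    from that(3,4) have "(a + b) mod k = a mod k" "(a' + b') mod k = a' mod k"
      by auto
    then have "a mod k = a' mod k"
      using that(5) by simp
    with that(1,2) A(1) have "a = a'"
      using inj_onD[OF inj_on_mod_Apery[OF S k(1)], of a a'] by blast
    with that show ?thesis by simp
  qed
  ultimately show ?thesis
    using A(2) unfolding AG_poly_code_solution_def by blast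
qed

lemma Max_multiples:
  fixes n k :: nat
  assumes "n \<ge> 1"
  shows "Max ((\<lambda>i. i * k) ` {..<n}) = (n - 1) * k"
  by (rule Max_eqI) (use assms in \<open>auto intro!: mult_le_mono1\<close>)

theorem mainTheorem3:
  fixes S :: "nat set" and m n m' :: nat and D\<^sub>A D\<^sub>B :: "nat set"
  assumes "numerical_semigroup S"
    and "m \<ge> 1" and "n \<ge> 1"
    and "m' = (LEAST s. s \<in> S \<and> s \<ge> m)"
    and "D\<^sub>A = smallest m (Apery S m')"
    and "D\<^sub>B = (\<lambda>i. i * m') ` {..<n}"
  shows "AG_poly_code_solution S m n D\<^sub>A D\<^sub>B
    \<and> recovery_threshold D\<^sub>A D\<^sub>B \<le> conductor S + m' * n
    \<and> conductor S + m' * n \<le> conductor S + (m + multiplicity S - 1) * n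
    \<and> (m \<in> S \<longrightarrow> m' = m \<and> recovery_threshold D\<^sub>A D\<^sub>B = conductor S + m * n)"
proof -
  note S = assms(1)
  obtain s where s: "s \<in> S" "s \<ge> m" "s \<le> m + multiplicity S - 1"
    by (rule semigroup_element_above[OF S])
  have m': "m' \<in> S \<and> m' \<ge> m"
    unfolding assms(4) by (rule LeastI[of _ s]) (use s in simp)
  have "m' \<le> s"
    unfolding assms(4) by (rule Least_le) (use s in simp)
  with s have le: "m' \<le> m + multiplicity S - 1" by simp
  have k: "m' \<in> S" "m' > 0"
    using m' assms(2) by auto
  have sub: "D\<^sub>A \<subseteq> Apery S m'"
    using smallest_subset assms(5) by simp
  have card: "card D\<^sub>A = m"
    using card_smallest[OF finite_Apery[OF S k]] card_Apery[OF S k] m' assms(5) by simp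
  have sol: "AG_poly_code_solution S m n D\<^sub>A D\<^sub>B"
    unfolding assms(6) by (rule AG_poly_code_solution_Apery[OF S k sub card])
  \<comment> \<open>Stated additively to avoid the subtraction in \<open>(n - 1) * m'\<close>; the
    \<open>m'\<close> cancels against the bound on \<open>Max D\<^sub>A\<close>.\<close>
  have MaxB: "Max D\<^sub>B + m' = m' * n"
    using Max_multiples[OF assms(3), of m'] assms(3,6) by (cases n) (auto simp: algebra_simps)
  have "D\<^sub>A \<noteq> {}"
    using card assms(2) by auto
  then have "Max D\<^sub>A \<in> D\<^sub>A"
    using finite_subset[OF sub finite_Apery[OF S k]] by simp
  then have "Max D\<^sub>A \<le> conductor S + m' - 1"
    using Apery_le[OF S _ k(2)] sub by blast
  then have threshold: "recovery_threshold D\<^sub>A D\<^sub>B \<le> conductor S + m' * n"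
    using MaxB k(2) unfolding recovery_threshold_def by linarith
  have "m' = m \<and> recovery_threshold D\<^sub>A D\<^sub>B = conductor S + m * n" if "m \<in> S"
  proof -
    have "m' \<le> m"
      unfolding assms(4) by (rule Least_le) (use that in simp)
    with m' have eq: "m' = m" by simp
    \<comment> \<open>The Apery set has exactly \<open>m' = m\<close> elements, so all are selected
      and the maximum is known exactly.\<close>
    then have "D\<^sub>A = Apery S m'"
      using smallest_card_self[OF finite_Apery[OF S k]] card_Apery[OF S k] assms(5) by simp
    then have "Max D\<^sub>A = conductor S + m' - 1"
      using Max_Apery[OF S k] by simp
    then have "recovery_threshold D\<^sub>A D\<^sub>B = conductor S + m' * n"
      using MaxB k(2) unfolding recovery_threshold_def by linarith
    with eq show ?thesis by simp
  qed
  with sol threshold le show ?thesis by simp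
qed

end
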